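(* Let $G$ be a nilpotent group and let $g:\mathbb{N}_0\to G$ be a polynomial sequence such that $G$ is generated by $\{g(i)\mid i\in\mathbb{N}_0\}$. Then every infinite subsequence of $g$ (not necessarily corresponding to an arithmetic progression) generates a finite index subgroup of $G$; that is, for every infinite subset $I\subseteq\mathbb{N}_0$, the subgroup of $G$ generated by $\{g(i)\mid i\in I\}$ has finite index in $G$.
   Context: $\mathbb{N}_0=\{0,1,2,\ldots\}$ is a commutative semigroup under addition. A polynomial sequence in a group $G$ is a polynomial map $\mathbb{N}_0\to G$, in the following sense. Let $S$ be a nonempty commutative semigroup (written additively) and $G$ a group with identity $1_G$. A map $f:S\to G$ is a polynomial map of degree $-\infty$ if $f(s)=1_G$ for all $s$, and of degree $0$ if it is constant with value different from $1_G$. Thus degree $\le 0$ means constant. Inductively, for $d\in\{0,1,2,\dots\}$, $f$ is a polynomial map of degree $\le d+1$ if for every $s\in S$ both maps $L_s(f):t\mapsto f(s+t)f(t)^{-1}$ and $R_s(f):t\mapsto f(t)^{-1}f(s+t)$ from $S$ to $G$ are polynomial maps of degree $\le d$. The degree of a polynomial map is the least such $d\in\{-\infty,0,1,2,\dots\}$. A map is a polynomial map if it is a polynomial map of degree $\le d$ for some $d$. *)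

theory Defs
  imports "HOL-Algebra.Generated_Groups"
begin

primrec lower_central_series :: "('a, 'b) monoid_scheme \<Rightarrow> nat \<Rightarrow> 'a set" where
  "lower_central_series G 0 = carrier G"
| "lower_central_series G (Suc n) =
     generate G {x \<otimes>\<^bsub>G\<^esub> y \<otimes>\<^bsub>G\<^esub> inv\<^bsub>G\<^esub> x \<otimes>\<^bsub>G\<^esub> inv\<^bsub>G\<^esub> y | x y.
                   x \<in> lower_central_series G n \<and> y \<in> carrier G}"

definition nilpotent_group :: "('a, 'b) monoid_scheme \<Rightarrow> bool" where
  "nilpotent_group G \<longleftrightarrow> group G \<and> (\<exists>n. lower_central_series G n = {\<one>\<^bsub>G\<^esub>})"

definition left_diff ::
  "('a, 'b) monoid_scheme \<Rightarrow> 's::ab_semigroup_add \<Rightarrow> ('s \<Rightarrow> 'a) \<Rightarrow> ('s \<Rightarrow> 'a)" where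
  "left_diff G s f = (\<lambda>t. f (s + t) \<otimes>\<^bsub>G\<^esub> inv\<^bsub>G\<^esub> (f t))"

definition right_diff ::
  "('a, 'b) monoid_scheme \<Rightarrow> 's::ab_semigroup_add \<Rightarrow> ('s \<Rightarrow> 'a) \<Rightarrow> ('s \<Rightarrow> 'a)" where
  "right_diff G s f = (\<lambda>t. inv\<^bsub>G\<^esub> (f t) \<otimes>\<^bsub>G\<^esub> f (s + t))"

text \<open>
  Degree at most \<open>0\<close> covers both the maps of degree minus infinity (constantly the identity)
  and those of degree \<open>0\<close> (constant with another value).
\<close>

primrec poly_map_deg_le ::
  "('a, 'b) monoid_scheme \<Rightarrow> nat \<Rightarrow> ('s::ab_semigroup_add \<Rightarrow> 'a) \<Rightarrow> bool" where
  "poly_map_deg_le G 0 f \<longleftrightarrow> (\<exists>c\<in>carrier G. \<forall>s. f s = c)"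
| "poly_map_deg_le G (Suc d) f \<longleftrightarrow>
     f \<in> UNIV \<rightarrow> carrier G \<and>
     (\<forall>s. poly_map_deg_le G d (left_diff G s f) \<and> poly_map_deg_le G d (right_diff G s f))"

definition poly_map :: "('a, 'b) monoid_scheme \<Rightarrow> ('s::ab_semigroup_add \<Rightarrow> 'a) \<Rightarrow> bool" where
  "poly_map G f \<longleftrightarrow> (\<exists>d. poly_map_deg_le G d f)"

end

theory Submission
  imports Defs "HOL-Computational_Algebra.Polynomial" "HOL-Algebra.Zassenhaus"
begin

text \<open>
  Let \<open>H\<close> be the subgroup generated by the terms \<open>g i\<close> with \<open>i \<in> I\<close>, and let \<open>\<gamma>\<close> denote the lower
  central series, so that \<open>\<gamma> 0 = G\<close> and \<open>\<gamma> 1\<close> is the derived subgroup.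

  In the abelianization of \<open>G\<close>, the sequence \<open>g\<close> becomes \<open>n \<mapsto> \<Sum>\<^sub>j (n choose j) c\<^sub>j\<close> with finitely many
  coefficients \<open>c\<^sub>j\<close>. Lagrange interpolation at sufficiently many points of \<open>I\<close>, with denominators
  cleared, shows that a positive multiple of each value lies in the image of \<open>H\<close>
  (\<open>poly_map_torsion_modulo_infinitely_many_values\<close>). Thus every \<open>g n\<close> has a positive power in
  \<open>H <#> \<gamma> 1\<close>. Moreover \<open>g\<close> is recovered from its differences, so \<open>G\<close> is generated by finitely many
  of the elements \<open>g n\<close> (\<open>poly_map_generated_by_initial_values\<close>).

  Nilpotency lifts this from the abelianization to \<open>G\<close>. Modulo \<open>\<gamma> (i + 2)\<close>, the commutator of an
  element of \<open>\<gamma> i\<close> and an element of \<open>G\<close> is multiplicative in both arguments. Therefore, if \<open>s [^] m\<close>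
  agrees modulo \<open>\<gamma> (i + 1)\<close> with an element \<open>h\<close> of \<open>H \<inter> \<gamma> i\<close> and \<open>t [^] n\<close> agrees modulo \<open>\<gamma> 1\<close> with
  an element \<open>h'\<close> of \<open>H\<close>, then the \<open>m * n\<close>-th power of the commutator of \<open>s\<close> and \<open>t\<close> agrees modulo
  \<open>\<gamma> (i + 2)\<close> with the commutator of \<open>h\<close> and \<open>h'\<close>, which lies in \<open>H \<inter> \<gamma> (i + 1)\<close>. By induction,
  \<open>\<gamma> i / ((H \<inter> \<gamma> i) <#> \<gamma> (i + 1))\<close> is a finitely generated abelian torsion group for every \<open>i\<close>
  (\<open>lower_central_factor_torsion_generators\<close>), hence finite. Combining the finitely many factors of
  a series that reaches the trivial group, finitely many cosets of \<open>H\<close> cover \<open>G\<close>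
  (\<open>nilpotent_finite_index_if_torsion_in_abelianization\<close>).
\<close>

section \<open>Integral interpolation\<close>

text \<open>
  Over a field this is Lagrange interpolation: the value of a polynomial of degree less than
  \<open>card X\<close> at \<open>n\<close> is a fixed linear combination of its values on \<open>X\<close>. The factor \<open>D\<close> clears the
  denominators, so that the relation can be used as an exponent relation in a group. One node \<open>a\<close>
  is split off by writing \<open>p x = p a + (x - a) * q x\<close>, where \<open>q\<close> is zero or of smaller degree.
\<close>
lemma integral_interpolation:
  fixes X :: "int set" and n :: int
  assumes "finite X"
  shows "\<exists>D w. D \<noteq> 0 \<and> (\<forall>p :: int poly. p = 0 \<or> degree p < card X \<longrightarrow> D * poly p n = (\<Sum>x\<in>X. w x * poly p x))"
  using assms
proof (induction X rule: finite_induct)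
  case empty
  then show ?case by (intro exI[of _ 1]) auto
next
  case (insert a X)
  then obtain D w where "D \<noteq> 0"
    and IH: "p = 0 \<or> degree p < card X \<Longrightarrow> D * poly p n = (\<Sum>x\<in>X. w x * poly p x)" for p :: "int poly"
    by blast
  \<comment> \<open>Multiplying by \<open>P\<close> turns every \<open>q x = (p x - p a) / (x - a)\<close> with \<open>x \<in> X\<close> into an integral expression.\<close>
  define P where "P = (\<Prod>x\<in>X. x - a)"
  define v where "v x = (n - a) * w x * (\<Prod>y\<in>X - {x}. y - a)" for x
  define u where "u x = (if x = a then D * P - sum v X else v x)" for x
  have "P \<noteq> 0"
    using insert.hyps by (auto simp: P_def)
  have "D * P * poly p n = (\<Sum>x\<in>insert a X. u x * poly p x)"
    if p: "p = 0 \<or> degree p < card (insert a X)" for p :: "int poly"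
  proof -
    define q where "q = synthetic_div p a"
    have eval: "poly p x = poly p a + (x - a) * poly q x" for x
      using arg_cong[OF synthetic_div_correct'[of a p], of "\<lambda>r. poly r x"]
      by (simp add: q_def algebra_simps)
    have "q = 0 \<or> degree q < card X"
      using p insert.hyps unfolding q_def synthetic_div_eq_0_iff degree_synthetic_div by auto
    then have q: "D * poly q n = (\<Sum>x\<in>X. w x * poly q x)"
      by (rule IH)
    have cofactor: "(n - a) * P * (w x * poly q x) = v x * (poly p x - poly p a)" if "x \<in> X" for x
    proof -
      have "P = (x - a) * (\<Prod>y\<in>X - {x}. y - a)"
        unfolding P_def using insert.hyps(1) that by (rule prod.remove)
      then show ?thesis by (simp add: v_def eval[of x])
    qed
    have "D * P * poly p n = D * P * poly p a + (n - a) * P * (D * poly q n)"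
      by (subst eval) (simp add: algebra_simps)
    also have "(n - a) * P * (D * poly q n) = (\<Sum>x\<in>X. v x * (poly p x - poly p a))"
      unfolding q sum_distrib_left using cofactor by (intro sum.cong) auto
    also have "D * P * poly p a + \<dots> = u a * poly p a + (\<Sum>x\<in>X. v x * poly p x)"
      by (simp add: u_def algebra_simps sum_subtractf sum_distrib_left sum_distrib_right)
    also have "(\<Sum>x\<in>X. v x * poly p x) = (\<Sum>x\<in>X. u x * poly p x)"
      using insert.hyps by (intro sum.cong) (auto simp: u_def)
    finally show ?thesis using insert.hyps by simp
  qed
  with \<open>D \<noteq> 0\<close> \<open>P \<noteq> 0\<close> show ?case
    by (intro exI[of _ "D * P"] exI[of _ u]) simp
qed

definition falling_poly :: "nat \<Rightarrow> int poly" where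
  "falling_poly j = (\<Prod>i<j. [:- int i, 1:])"

lemma degree_falling_poly: "degree (falling_poly j) = j"
  unfolding falling_poly_def by (subst degree_prod_eq_sum_degree) auto

lemma poly_falling_poly: "poly (falling_poly j) (int n) = fact j * int (n choose j)"
proof -
  have "real_of_int (poly (falling_poly j) (int n)) = (\<Prod>i<j. real n - real i)"
    by (simp add: falling_poly_def poly_prod)
  also have "\<dots> = fact j * (real n gchoose j)"
    by (simp add: gbinomial_mult_fact atLeast0LessThan)
  also have "\<dots> = real_of_int (fact j * int (n choose j))"
    by (simp add: binomial_gbinomial)
  finally show ?thesis by (simp only: of_int_eq_iff)
qed

text \<open>
  A polynomial map into an abelian group is a combination of binomial coefficients, whose
  coefficients as polynomials are not integers. The relation is therefore obtained for falling
  factorials, after which the factor \<open>fact j\<close> cancels. One choice of weights has to serve all \<open>j\<close> at once, as they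
  become the exponents of a relation between values of the map.
\<close>
lemma binomial_interpolation:
  fixes X :: "nat set"
  assumes "finite X" "d < card X"
  obtains D :: nat and w :: "nat \<Rightarrow> int" where "D > 0"
    and "\<And>j. j \<le> d \<Longrightarrow> int D * int (n choose j) = (\<Sum>x\<in>X. w x * int (x choose j))"
proof -
  have card: "card (int ` X) = card X"
    by (simp add: card_image)
  obtain D w where "D \<noteq> 0"
    and *: "\<And>p :: int poly. p = 0 \<or> degree p < card X \<Longrightarrow>
          D * poly p (int n) = (\<Sum>x\<in>int ` X. w x * poly p x)"
    using integral_interpolation[of "int ` X" "int n"] assms(1) unfolding card by blast
  have "int (nat \<bar>D\<bar>) * int (n choose j) = (\<Sum>x\<in>X. sgn D * w (int x) * int (x choose j))"
    if "j \<le> d" for j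
  proof -
    have "fact j * (D * int (n choose j)) = fact j * (\<Sum>x\<in>X. w (int x) * int (x choose j))"
      using *[of "falling_poly j"] that assms(2)
      by (simp add: degree_falling_poly poly_falling_poly sum.reindex sum_distrib_left mult_ac)
    then have "D * int (n choose j) = (\<Sum>x\<in>X. w (int x) * int (x choose j))"
      by simp
    then have "sgn D * (D * int (n choose j)) = sgn D * (\<Sum>x\<in>X. w (int x) * int (x choose j))"
      by simp
    moreover have "int (nat \<bar>D\<bar>) = sgn D * D"
      by (simp add: sgn_if)
    ultimately show ?thesis
      by (simp only: sum_distrib_left mult.assoc)
  qed
  with \<open>D \<noteq> 0\<close> show thesis
    by (intro that[of "nat \<bar>D\<bar>" "\<lambda>x. sgn D * w (int x)"]) auto
qed

section \<open>Polynomial sequences\<close>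
lemma poly_map_deg_le_closed:
  assumes "poly_map_deg_le G d f"
  shows "f s \<in> carrier G"
  using assms by (cases d) auto

lemma (in group_hom) poly_map_deg_le_hom:
  assumes "poly_map_deg_le G d f"
  shows "poly_map_deg_le H d (\<lambda>s. h (f s))"
  using assms
proof (induction d arbitrary: f)
  case (Suc d)
  then have f: "f t \<in> carrier G" for t
    using poly_map_deg_le_closed by blast
  have "left_diff H s (\<lambda>t. h (f t)) = (\<lambda>t. h (left_diff G s f t))"
       "right_diff H s (\<lambda>t. h (f t)) = (\<lambda>t. h (right_diff G s f t))" for s
    using f by (simp_all add: left_diff_def right_diff_def)
  with Suc f show ?case by simp
qed auto

text \<open>
  As in the Newton expansion, \<open>f (n + 1) = \<Delta>f n \<otimes> f n\<close> with \<open>\<Delta>f\<close> of smaller degree. This is the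
  source of finite generation: a group generated by a polynomial sequence is generated by finitely
  many of its terms.
\<close>
lemma (in group) poly_map_generated_by_initial_values:
  fixes f :: "nat \<Rightarrow> 'a"
  assumes "poly_map_deg_le G d f"
  shows "f n \<in> generate G (f ` {..d})"
  using assms
proof (induction d arbitrary: f n)
  case 0
  then show ?case by (metis atMost_iff generate.incl image_eqI order_refl poly_map_deg_le.simps(1))
next
  case (Suc d)
  have f: "f t \<in> carrier G" for t
    using Suc.prems poly_map_deg_le_closed by blast
  let ?K = "generate G (f ` {..Suc d})" and ?D = "left_diff G 1 f"
  have K: "subgroup ?K G"
    using f by (intro generate_is_subgroup) auto
  have "f t \<in> ?K" if "t \<le> Suc d" for t
    using that by (intro generate.incl) auto
  then have "?D ` {..d} \<subseteq> ?K"
    using subgroupE(3,4)[OF K] by (auto simp: left_diff_def)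
  then have D: "?D t \<in> ?K" for t
    using Suc.IH[of ?D t] Suc.prems generate_subgroup_incl[OF _ K] by auto
  show ?case
  proof (induction n)
    case 0
    then show ?case by (intro generate.incl) auto
  next
    case (Suc n)
    have "f (Suc n) = ?D n \<otimes> f n"
      using f by (simp add: left_diff_def m_assoc)
    with Suc D generate.eng show ?case by metis
  qed
qed

text \<open>
  The Newton expansion \<open>f n = \<Prod>\<^sub>j c\<^sub>j ^ (n choose j)\<close>, where \<open>j\<close> runs up to \<open>d\<close> and \<open>c\<^sub>j\<close> is the
  \<open>j\<close>-th difference of \<open>f\<close> at \<open>0\<close>. It is packaged as the homomorphism
  \<open>\<phi> v = \<Prod>\<^sub>j c\<^sub>j ^ v j\<close> on integer vectors, so that integral linear relations between binomial
  vectors transfer to relations between values of \<open>f\<close>.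
\<close>
lemma (in comm_group) poly_map_newton_expansion:
  fixes f :: "nat \<Rightarrow> 'a"
  assumes "poly_map_deg_le G d f"
  shows "\<exists>\<phi> :: (nat \<Rightarrow> int) \<Rightarrow> 'a.
           (\<forall>v. \<phi> v \<in> carrier G) \<and>
           (\<forall>v w. \<phi> (\<lambda>j. v j + w j) = \<phi> v \<otimes> \<phi> w) \<and>
           (\<forall>v w. (\<forall>j\<le>d. v j = w j) \<longrightarrow> \<phi> v = \<phi> w) \<and>
           (\<forall>n. f n = \<phi> (\<lambda>j. int (n choose j)))"
  using assms
proof (induction d arbitrary: f)
  case 0
  then obtain c where "c \<in> carrier G" "\<And>s. f s = c" by auto
  then show ?case
    by (intro exI[of _ "\<lambda>v. c [^] v 0"]) (auto simp: int_pow_mult)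
next
  case (Suc d)
  have f: "f t \<in> carrier G" for t
    using Suc.prems poly_map_deg_le_closed by blast
  let ?D = "left_diff G 1 f"
  obtain \<psi> :: "(nat \<Rightarrow> int) \<Rightarrow> 'a" where closed: "\<And>v. \<psi> v \<in> carrier G"
    and add: "\<And>v w. \<psi> (\<lambda>j. v j + w j) = \<psi> v \<otimes> \<psi> w"
    and cong: "\<And>v w. (\<forall>j\<le>d. v j = w j) \<Longrightarrow> \<psi> v = \<psi> w"
    and D: "\<And>n. ?D n = \<psi> (\<lambda>j. int (n choose j))"
    using Suc.IH[of ?D] Suc.prems by auto
  define \<phi> where "\<phi> v = f 0 [^] v 0 \<otimes> \<psi> (\<lambda>j. v (Suc j))" for v :: "nat \<Rightarrow> int"
  have "\<psi> (\<lambda>j. 0) = \<one>"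
    using add[of "\<lambda>j. 0" "\<lambda>j. 0"] closed by (simp add: l_cancel_one')
  have f_eq: "f n = \<phi> (\<lambda>j. int (n choose j))" for n
  proof (induction n)
    case 0
    then show ?case
      using f \<open>\<psi> (\<lambda>j. 0) = \<one>\<close> by (simp add: \<phi>_def)
  next
    case (Suc n)
    have "f (Suc n) = ?D n \<otimes> f n"
      using f by (simp add: left_diff_def m_assoc)
    also have "\<dots> = f 0 \<otimes> (\<psi> (\<lambda>j. int (n choose j)) \<otimes> \<psi> (\<lambda>j. int (n choose Suc j)))"
      using f closed by (simp add: D[simplified] Suc \<phi>_def m_lcomm)
    also have "\<dots> = \<phi> (\<lambda>j. int (Suc n choose j))"
      using f by (simp add: \<phi>_def flip: add)
    finally show ?case .
  qed
  have "\<phi> v \<in> carrier G" for v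
    using f closed by (simp add: \<phi>_def)
  moreover have "\<phi> (\<lambda>j. v j + w j) = \<phi> v \<otimes> \<phi> w" for v w
    using f closed by (simp add: \<phi>_def add int_pow_mult m_ac)
  moreover have "\<phi> v = \<phi> w" if "\<forall>j\<le>Suc d. v j = w j" for v w
    using that cong[of "\<lambda>j. v (Suc j)" "\<lambda>j. w (Suc j)"] by (simp add: \<phi>_def)
  ultimately show ?case using f_eq by blast
qed

text \<open>
  Modulo \<open>K\<close>, the map \<open>f\<close> has \<open>d + 1\<close> zeros, more than its degree. Interpolation expresses a positive
  multiple (in additive terms) of any value through the values at these zeros. Over a field \<open>f\<close> would
  vanish modulo \<open>K\<close>; here the denominators leave the exponent \<open>D\<close>.
\<close>
lemma (in comm_group) poly_map_torsion_modulo_infinitely_many_values: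
  fixes f :: "nat \<Rightarrow> 'a"
  assumes f: "poly_map_deg_le G d f" and K: "subgroup K G"
    and "infinite I" and I: "f ` I \<subseteq> K"
  obtains D :: nat where "D > 0" and "f n [^] D \<in> K"
proof -
  obtain \<phi> :: "(nat \<Rightarrow> int) \<Rightarrow> 'a" where closed: "\<And>v. \<phi> v \<in> carrier G"
    and add: "\<And>v w. \<phi> (\<lambda>j. v j + w j) = \<phi> v \<otimes> \<phi> w"
    and cong: "\<And>v w. (\<forall>j\<le>d. v j = w j) \<Longrightarrow> \<phi> v = \<phi> w"
    and f_eq: "\<And>n. f n = \<phi> (\<lambda>j. int (n choose j))"
    using poly_map_newton_expansion[OF f] by blast
  have zero: "\<phi> (\<lambda>j. 0) = \<one>"
    using add[of "\<lambda>j. 0" "\<lambda>j. 0"] closed by (simp add: l_cancel_one')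
  have minus: "\<phi> (\<lambda>j. - v j) = inv \<phi> v" for v
    using add[of "\<lambda>j. - v j" v] closed zero by (simp add: inv_equality)
  have mult_nat: "\<phi> (\<lambda>j. int m * v j) = \<phi> v [^] m" for m v
    by (induction m) (simp_all add: zero add ring_distribs m_comm closed)
  have mult: "\<phi> (\<lambda>j. k * v j) \<in> K" if v: "\<phi> v \<in> K" for k v
  proof -
    have pow: "\<phi> v [^] m \<in> K" for m :: nat
      using subgroup_int_pow_closed[OF K v, of "int m"] by (simp add: int_pow_int)
    show ?thesis
    proof (cases k rule: int_cases2)
      case (nonneg m)
      then show ?thesis using pow by (simp add: mult_nat)
    next
      case (nonpos m)
      then show ?thesis
        using pow subgroupE(3)[OF K] by (simp add: minus mult_nat)
    qed
  qed
  have sum: "\<phi> (\<lambda>j. \<Sum>x\<in>X. w x * int (x choose j)) \<in> K" if "finite X" "X \<subseteq> I" for X w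
    using that
  proof (induction X rule: finite_induct)
    case empty
    then show ?case using zero subgroup.one_closed[OF K] by simp
  next
    case (insert x X)
    then have "\<phi> (\<lambda>j. w x * int (x choose j)) \<in> K"
      using I by (intro mult) (auto simp flip: f_eq)
    with insert show ?case using subgroup.m_closed[OF K] by (simp add: add)
  qed
  obtain X where X: "X \<subseteq> I" "finite X" "card X = Suc d"
    using infinite_arbitrarily_large[OF \<open>infinite I\<close>] by blast
  then obtain D w where "D > 0"
    and "\<And>j. j \<le> d \<Longrightarrow> int D * int (n choose j) = (\<Sum>x\<in>X. w x * int (x choose j))"
    using binomial_interpolation[of X d] by (metis lessI)
  then have "\<phi> (\<lambda>j. int D * int (n choose j)) = \<phi> (\<lambda>j. \<Sum>x\<in>X. w x * int (x choose j))"
    by (intro cong) simp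
  with sum[OF X(2,1)] have "f n [^] D \<in> K"
    by (simp add: f_eq mult_nat)
  with \<open>D > 0\<close> show thesis by (rule that)
qed

section \<open>Commutator identities\<close>

definition commutator :: "('a, 'b) monoid_scheme \<Rightarrow> 'a \<Rightarrow> 'a \<Rightarrow> 'a" where
  "commutator G x y = x \<otimes>\<^bsub>G\<^esub> y \<otimes>\<^bsub>G\<^esub> inv\<^bsub>G\<^esub> x \<otimes>\<^bsub>G\<^esub> inv\<^bsub>G\<^esub> y"

definition central :: "('a, 'b) monoid_scheme \<Rightarrow> 'a \<Rightarrow> bool" where
  "central G z \<longleftrightarrow> z \<in> carrier G \<and> (\<forall>y\<in>carrier G. z \<otimes>\<^bsub>G\<^esub> y = y \<otimes>\<^bsub>G\<^esub> z)"

lemma (in group_hom) hom_commutator: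
  assumes "x \<in> carrier G" "y \<in> carrier G"
  shows "h (commutator G x y) = commutator H (h x) (h y)"
  using assms by (simp add: commutator_def)

lemma (in normal) r_coset_eqD:
  assumes "x \<in> carrier G" "y \<in> carrier G" "H #> y = H #> x"
  shows "\<exists>c\<in>H. x = y \<otimes> c"
proof -
  have "x \<in> H #> y"
    by (rule repr_independenceD[OF subgroup_axioms assms(1,3)])
  also have "H #> y = y <# H"
    using coset_eq assms(2) by simp
  finally show ?thesis
    unfolding l_coset_def by auto
qed

context group
begin

lemma inv_cancel_left:
  assumes "x \<in> carrier G" "y \<in> carrier G"
  shows "inv x \<otimes> (x \<otimes> y) = y" "x \<otimes> (inv x \<otimes> y) = y"
  using assms by (simp_all flip: m_assoc)

lemma commutator_closed [simp]:
  "x \<in> carrier G \<Longrightarrow> y \<in> carrier G \<Longrightarrow> commutator G x y \<in> carrier G"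
  by (simp add: commutator_def)

lemma commutator_mult_swap:
  assumes "x \<in> carrier G" "y \<in> carrier G"
  shows "x \<otimes> y = commutator G x y \<otimes> (y \<otimes> x)"
  using assms by (simp add: commutator_def m_assoc inv_cancel_left)

lemma commutator_one [simp]:
  "x \<in> carrier G \<Longrightarrow> commutator G x \<one> = \<one>" "x \<in> carrier G \<Longrightarrow> commutator G \<one> x = \<one>"
  by (simp_all add: commutator_def)

lemma commutator_eq_one_if_central:
  assumes "central G z" "y \<in> carrier G"
  shows "commutator G z y = \<one>"
  using assms commutator_mult_swap[of z y] unfolding central_def
  by (metis commutator_closed m_closed r_cancel_one)

lemma inv_commutator:
  "x \<in> carrier G \<Longrightarrow> y \<in> carrier G \<Longrightarrow> inv (commutator G x y) = commutator G y x"
  by (simp add: commutator_def inv_mult_group m_assoc)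

text \<open>
  The correction to multiplicativity is itself a commutator with \<open>commutator G x z\<close>, one step
  further down the lower central series.
\<close>
lemma commutator_mult_right:
  assumes "x \<in> carrier G" "y \<in> carrier G" "z \<in> carrier G"
  shows "commutator G x (y \<otimes> z) =
    commutator G x y \<otimes> commutator G y (commutator G x z) \<otimes> commutator G x z"
  using assms by (simp add: commutator_def inv_mult_group m_assoc inv_cancel_left)

lemma commutator_mult_left:
  assumes "x \<in> carrier G" "y \<in> carrier G" "z \<in> carrier G"
  shows "commutator G (x \<otimes> y) z =
    commutator G x (commutator G y z) \<otimes> commutator G y z \<otimes> commutator G x z"
  using assms by (simp add: commutator_def inv_mult_group m_assoc inv_cancel_left)

lemma commutator_central_right:
  assumes "x \<in> carrier G" "central G z"
  shows "commutator G x z = \<one>"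
  using assms commutator_eq_one_if_central[OF assms(2,1)] inv_commutator[of z x]
  by (simp add: central_def)

lemma commutator_hom_right:
  assumes "x \<in> carrier G" "y \<in> carrier G" "z \<in> carrier G" "central G (commutator G x z)"
  shows "commutator G x (y \<otimes> z) = commutator G x y \<otimes> commutator G x z"
  using assms by (simp add: commutator_mult_right commutator_central_right)

lemma commutator_hom_left:
  assumes "x \<in> carrier G" "y \<in> carrier G" "z \<in> carrier G" "central G (commutator G y z)"
  shows "commutator G (x \<otimes> y) z = commutator G y z \<otimes> commutator G x z"
  using assms by (simp add: commutator_mult_left commutator_central_right)

lemma commutator_pow_right:
  assumes "x \<in> carrier G" "y \<in> carrier G" "central G (commutator G x y)"
  shows "commutator G x (y [^] (n::nat)) = commutator G x y [^] n"
  using assms by (induction n) (simp_all add: commutator_hom_right)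

lemma commutator_pow_left:
  assumes "x \<in> carrier G" "y \<in> carrier G" "central G (commutator G x y)"
  shows "commutator G (x [^] (n::nat)) y = commutator G x y [^] n"
  using assms by (induction n) (simp_all add: commutator_hom_left nat_pow_comm flip: nat_pow_Suc2)

text \<open>
  Under the centrality hypothesis, \<open>y \<mapsto> commutator G x y\<close> is a homomorphism into the centre. The
  centre is abelian, so the homomorphism kills commutators.
\<close>
lemma commutator_derived_right:
  assumes x: "x \<in> carrier G"
    and central: "\<And>y. y \<in> carrier G \<Longrightarrow> central G (commutator G x y)"
    and z: "z \<in> derived G (carrier G)"
  shows "commutator G x z = \<one>"
proof -
  note hom = commutator_hom_right[OF x _ _ central]
  have "subgroup {y \<in> carrier G. commutator G x y = \<one>} G"
  proof (rule subgroupI)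
    fix y assume "y \<in> {y \<in> carrier G. commutator G x y = \<one>}"
    then show "inv y \<in> {y \<in> carrier G. commutator G x y = \<one>}"
      using hom[of y "inv y"] x by simp
  qed (use x hom in auto)
  moreover have "derived_set G (carrier G) \<subseteq> {y \<in> carrier G. commutator G x y = \<one>}"
  proof clarify
    fix u v assume u: "u \<in> carrier G" and v: "v \<in> carrier G"
    have "commutator G x (u \<otimes> v) = commutator G x (v \<otimes> u)"
      using u v x central[OF v] by (simp add: hom) (simp add: central_def)
    moreover have "commutator G x (u \<otimes> v) =
        commutator G x (commutator G u v) \<otimes> commutator G x (v \<otimes> u)"
      using u v by (simp add: commutator_mult_swap[OF u v] hom)
    ultimately have "commutator G x (commutator G u v) = \<one>"
      using u v x by (metis commutator_closed m_closed r_cancel_one')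
    then show "u \<otimes> v \<otimes> inv u \<otimes> inv v \<in> carrier G \<and> commutator G x (u \<otimes> v \<otimes> inv u \<otimes> inv v) = \<one>"
      using u v by (simp add: commutator_def)
  qed
  ultimately show ?thesis
    using generate_subgroup_incl z unfolding derived_def by blast
qed

text \<open>
  Bimultiplicativity of the commutator turns powers of \<open>s\<close> and \<open>t\<close> that lie in a subgroup, up to
  the corrections \<open>l\<close> and \<open>l'\<close>, into a power of \<open>commutator G s t\<close> that lies in the subgroup. The
  corrections disappear: \<open>l\<close> is central, and \<open>l'\<close> commutes with \<open>h\<close> by \<open>commutator_derived_right\<close>.
\<close>
lemma commutator_pow_of_congruent_powers:
  fixes m n :: nat
  assumes elems: "s \<in> carrier G" "t \<in> carrier G" "h \<in> carrier G" "h' \<in> carrier G" "l' \<in> carrier G"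
    and s: "\<And>y. y \<in> carrier G \<Longrightarrow> central G (commutator G s y)"
    and h: "\<And>y. y \<in> carrier G \<Longrightarrow> central G (commutator G h y)"
    and l: "central G l" and l': "l' \<in> derived G (carrier G)"
    and pow: "s [^] m = h \<otimes> l" "t [^] n = h' \<otimes> l'"
  shows "commutator G s t [^] (m * n) = commutator G h h'"
proof -
  have lG: "l \<in> carrier G"
    using l by (simp add: central_def)
  have one: "central G \<one>"
    by (simp add: central_def)
  have hl: "commutator G (h \<otimes> l) y = commutator G h y" if "y \<in> carrier G" for y
    using that elems lG l one by (simp add: commutator_hom_left commutator_eq_one_if_central)
  have "commutator G s t [^] (m * n) = commutator G (s [^] m) t [^] n"
    using elems s by (simp add: commutator_pow_left nat_pow_pow)
  also have "\<dots> = commutator G h t [^] n"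
    using elems by (simp add: pow hl)
  also have "\<dots> = commutator G h (h' \<otimes> l')"
    using elems h by (simp add: commutator_pow_right flip: pow)
  also have "\<dots> = commutator G h h'"
    using elems one by (simp add: commutator_hom_right commutator_derived_right[OF elems(3) h l'])
  finally show ?thesis .
qed

text \<open>
  This is \<open>commutator_pow_of_congruent_powers\<close> for the quotient group \<open>Q = G Mod N\<close>. Naming the quotient \<open>Q\<close>
  and its projection \<open>\<pi>\<close> keeps its operations from being unfolded to operations on sets of cosets.
\<close>
lemma commutator_pow_modulo_normal:
  fixes m n :: nat
  assumes N: "N \<lhd> G"
    and elems: "s \<in> carrier G" "t \<in> carrier G" "h \<in> carrier G" "h' \<in> carrier G" "l \<in> carrier G"
    and s: "\<And>y z. y \<in> carrier G \<Longrightarrow> z \<in> carrier G \<Longrightarrow> commutator G (commutator G s y) z \<in> N"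
    and h: "\<And>y z. y \<in> carrier G \<Longrightarrow> z \<in> carrier G \<Longrightarrow> commutator G (commutator G h y) z \<in> N"
    and l: "\<And>z. z \<in> carrier G \<Longrightarrow> commutator G l z \<in> N" and l': "l' \<in> derived G (carrier G)"
    and pow: "s [^] m = h \<otimes> l" "t [^] n = h' \<otimes> l'"
  shows "\<exists>c\<in>N. commutator G s t [^] (m * n) = commutator G h h' \<otimes> c"
proof -
  interpret N: normal N G by (rule N)
  define Q where "Q = G Mod N"
  define \<pi> where "\<pi> = (\<lambda>x. N #> x)"
  interpret \<pi>: group_hom G Q \<pi>
    unfolding Q_def \<pi>_def
    by (intro group_hom.intro group_hom_axioms.intro N.factorgroup_is_group N.r_coset_hom_Mod is_group)
  have surj: "carrier Q = \<pi> ` carrier G"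
    by (simp add: Q_def \<pi>_def carrier_FactGroup)
  have ker: "\<pi> x = \<one>\<^bsub>Q\<^esub>" if "x \<in> N" for x
    using N.rcos_const[OF is_group that] by (simp add: Q_def \<pi>_def)
  have l'G: "l' \<in> carrier G"
    using l' derived_in_carrier by blast
  have central: "central Q (\<pi> x)" if x: "x \<in> carrier G"
    and xN: "\<And>z. z \<in> carrier G \<Longrightarrow> commutator G x z \<in> N" for x
  proof -
    have "\<pi> x \<otimes>\<^bsub>Q\<^esub> \<pi> z = \<pi> z \<otimes>\<^bsub>Q\<^esub> \<pi> x" if z: "z \<in> carrier G" for z
    proof -
      have "commutator Q (\<pi> x) (\<pi> z) = \<one>\<^bsub>Q\<^esub>"
        using \<pi>.hom_commutator[OF x z] ker[OF xN[OF z]] by simp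
      then show ?thesis
        using \<pi>.H.commutator_mult_swap[of "\<pi> x" "\<pi> z"] x z by simp
    qed
    with x show ?thesis
      by (auto simp: central_def surj)
  qed
  have central_comm: "central Q (commutator Q (\<pi> x) y)"
    if x: "x \<in> carrier G" and y: "y \<in> carrier Q"
      and xN: "\<And>y z. y \<in> carrier G \<Longrightarrow> z \<in> carrier G \<Longrightarrow> commutator G (commutator G x y) z \<in> N" for x y
  proof -
    obtain u where u: "u \<in> carrier G" "y = \<pi> u"
      using y surj by auto
    have "central Q (\<pi> (commutator G x u))"
      using x u xN by (intro central) auto
    then show ?thesis
      using x u by (simp add: \<pi>.hom_commutator)
  qed
  have "commutator Q (\<pi> s) (\<pi> t) [^]\<^bsub>Q\<^esub> (m * n) = commutator Q (\<pi> h) (\<pi> h')"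
  proof (rule \<pi>.H.commutator_pow_of_congruent_powers)
    show "central Q (commutator Q (\<pi> s) y)" "central Q (commutator Q (\<pi> h) y)" if "y \<in> carrier Q" for y
      using central_comm that s h elems by blast+
    show "central Q (\<pi> l)"
      using central elems l by blast
    show "\<pi> l' \<in> derived Q (carrier Q)"
      using l' \<pi>.derived_img[of "carrier G"] by (simp add: surj)
    show "\<pi> s [^]\<^bsub>Q\<^esub> m = \<pi> h \<otimes>\<^bsub>Q\<^esub> \<pi> l" "\<pi> t [^]\<^bsub>Q\<^esub> n = \<pi> h' \<otimes>\<^bsub>Q\<^esub> \<pi> l'"
      using elems l'G by (simp_all flip: \<pi>.hom_nat_pow \<pi>.hom_mult pow)
  qed (use elems l'G in auto)
  then have "\<pi> (commutator G s t [^] (m * n)) = \<pi> (commutator G h h')"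
    using elems by (simp add: \<pi>.hom_commutator \<pi>.hom_nat_pow)
  then have "commutator G s t [^] (m * n) \<in> N #> commutator G h h'"
    unfolding \<pi>_def using elems by (intro repr_independenceD N.subgroup_axioms) auto
  also have "N #> commutator G h h' = commutator G h h' <# N"
    using N.coset_eq elems by auto
  finally show ?thesis
    unfolding l_coset_def by auto
qed

text \<open>
  If \<open>commutator G z (commutator G x y)\<close> is in \<open>U\<close> for all \<open>x \<in> A\<close>, then the commutator is
  multiplicative modulo \<open>U\<close> in each argument, hence determined there by its values on generators.
\<close>
lemma commutators_in_subgroup_of_generators:
  assumes U: "subgroup U G" and A: "subgroup A G"
    and nested: "\<And>x y z. x \<in> A \<Longrightarrow> y \<in> carrier G \<Longrightarrow> z \<in> carrier G \<Longrightarrow> commutator G z (commutator G x y) \<in> U"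
    and S: "S \<subseteq> A" "A \<subseteq> generate G S" and X: "X \<subseteq> carrier G" "carrier G \<subseteq> generate G X"
    and base: "\<And>s x. s \<in> S \<Longrightarrow> x \<in> X \<Longrightarrow> commutator G s x \<in> U"
    and "a \<in> A" "g \<in> carrier G"
  shows "commutator G a g \<in> U"
proof -
  note U_rules = subgroup.m_closed[OF U] subgroupE(3)[OF U] subgroup.mem_carrier[OF U]
  note AG = subgroup.mem_carrier[OF A]
  have cancel: "c \<in> U" if "u \<otimes> c = \<one>" "u \<in> U" "c \<in> carrier G" for u c
  proof -
    have "inv c = u"
      using inv_equality[OF that(1) that(3) subgroup.mem_carrier[OF U that(2)]] .
    then have "c = inv u"
      using inv_inv[OF that(3)] by simp
    then show ?thesis
      using U_rules(2)[OF that(2)] by simp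
  qed
  have right: "commutator G s y \<in> U" if s: "s \<in> S" and "y \<in> carrier G" for s y
  proof -
    have sA: "s \<in> A" "s \<in> carrier G"
      using s S AG by auto
    \<comment> \<open>Extend first the second argument from \<open>X\<close> to \<open>G\<close>, with the first one fixed in \<open>S\<close>.\<close>
    have "subgroup {y \<in> carrier G. commutator G s y \<in> U} G"
    proof (rule subgroupI)
      fix y assume "y \<in> {y \<in> carrier G. commutator G s y \<in> U}"
      then have y: "y \<in> carrier G" "commutator G s y \<in> U" by auto
      have eq: "commutator G s y \<otimes> commutator G y (commutator G s (inv y)) \<otimes> commutator G s (inv y) = \<one>"
        using commutator_mult_right[of s y "inv y"] y sA by simp
      have "commutator G y (commutator G s (inv y)) \<in> U"
        using nested[OF sA(1) inv_closed[OF y(1)] y(1)] .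
      then have "commutator G s (inv y) \<in> U"
        by (rule cancel[OF eq U_rules(1)[OF y(2)] commutator_closed[OF sA(2) inv_closed[OF y(1)]]])
      with y(1) show "inv y \<in> {y \<in> carrier G. commutator G s y \<in> U}"
        by simp
    next
      fix y z
      assume "y \<in> {y \<in> carrier G. commutator G s y \<in> U}" "z \<in> {y \<in> carrier G. commutator G s y \<in> U}"
      then have yz: "y \<in> carrier G" "commutator G s y \<in> U" "z \<in> carrier G" "commutator G s z \<in> U" by auto
      moreover have "commutator G y (commutator G s z) \<in> U"
        using nested[OF sA(1) yz(3) yz(1)] .
      ultimately show "y \<otimes> z \<in> {y \<in> carrier G. commutator G s y \<in> U}"
        using sA(2) U_rules(1) by (simp add: commutator_mult_right)
    next
      have "\<one> \<in> {y \<in> carrier G. commutator G s y \<in> U}"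
        using sA subgroup.one_closed[OF U] by simp
      then show "{y \<in> carrier G. commutator G s y \<in> U} \<noteq> {}" by blast
    qed auto
    moreover have "X \<subseteq> {y \<in> carrier G. commutator G s y \<in> U}"
      using X base s by auto
    ultimately have "generate G X \<subseteq> {y \<in> carrier G. commutator G s y \<in> U}"
      by (intro generate_subgroup_incl)
    with X(2) \<open>y \<in> carrier G\<close> show ?thesis
      by auto
  qed
  have "subgroup {a \<in> A. \<forall>y\<in>carrier G. commutator G a y \<in> U} G"
  proof (rule subgroupI)
    fix a assume "a \<in> {a \<in> A. \<forall>y\<in>carrier G. commutator G a y \<in> U}"
    then have a: "a \<in> A" "a \<in> carrier G" "inv a \<in> A" "\<And>y. y \<in> carrier G \<Longrightarrow> commutator G a y \<in> U"
      using AG subgroupE(3)[OF A] by auto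
    have "commutator G (inv a) y \<in> U" if y: "y \<in> carrier G" for y
    proof -
      have eq: "commutator G (inv a) (commutator G a y) \<otimes> commutator G a y \<otimes> commutator G (inv a) y = \<one>"
        using commutator_mult_left[of "inv a" a y] y a by simp
      have "commutator G (inv a) (commutator G a y) \<in> U"
        using nested[OF a(1) y inv_closed[OF a(2)]] .
      then show ?thesis
        by (rule cancel[OF eq U_rules(1)[OF _ a(4)[OF y]] commutator_closed[OF inv_closed[OF a(2)] y]])
    qed
    then show "inv a \<in> {a \<in> A. \<forall>y\<in>carrier G. commutator G a y \<in> U}"
      using a by simp
  next
    fix a b
    assume "a \<in> {a \<in> A. \<forall>y\<in>carrier G. commutator G a y \<in> U}"
      "b \<in> {a \<in> A. \<forall>y\<in>carrier G. commutator G a y \<in> U}"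
    then have ab: "a \<in> A" "b \<in> A" "a \<in> carrier G" "b \<in> carrier G"
      "\<And>y. y \<in> carrier G \<Longrightarrow> commutator G a y \<in> U" "\<And>y. y \<in> carrier G \<Longrightarrow> commutator G b y \<in> U"
      using AG by auto
    moreover have "commutator G a (commutator G b y) \<in> U" if "y \<in> carrier G" for y
      using nested[OF ab(2) that ab(3)] .
    ultimately show "a \<otimes> b \<in> {a \<in> A. \<forall>y\<in>carrier G. commutator G a y \<in> U}"
      using U_rules(1) subgroup.m_closed[OF A ab(1,2)] by (simp add: commutator_mult_left)
  next
    have "\<one> \<in> {a \<in> A. \<forall>y\<in>carrier G. commutator G a y \<in> U}"
      using subgroup.one_closed[OF U] subgroup.one_closed[OF A] by simp
    then show "{a \<in> A. \<forall>y\<in>carrier G. commutator G a y \<in> U} \<noteq> {}" by blast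
  qed (use AG in auto)
  moreover have "S \<subseteq> {a \<in> A. \<forall>y\<in>carrier G. commutator G a y \<in> U}"
    using S right by auto
  ultimately have "generate G S \<subseteq> {a \<in> A. \<forall>y\<in>carrier G. commutator G a y \<in> U}"
    by (intro generate_subgroup_incl)
  with S(2) \<open>a \<in> A\<close> \<open>g \<in> carrier G\<close> show ?thesis
    by auto
qed

section \<open>Finite covers by cosets\<close>

text \<open>
  A finitely generated abelian torsion group is finite; here the group is \<open>generate G (S \<union> B) / B\<close>.
  Generators are adjoined one at a time: since \<open>s\<close> normalises the group \<open>C\<close> obtained so far, adjoining
  it gives all \<open>c \<otimes> s [^] k\<close> with \<open>c \<in> C\<close>, and exponents matter only modulo the order of \<open>s\<close>
  over \<open>B\<close>.
\<close>
lemma finite_cover_of_torsion_extension: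
  assumes B: "subgroup B G" and A: "subgroup A G" and "finite S" "S \<subseteq> A" "B \<subseteq> A"
    and comm: "\<And>x y. x \<in> A \<Longrightarrow> y \<in> A \<Longrightarrow> commutator G x y \<in> B"
    and tors: "\<And>s. s \<in> S \<Longrightarrow> \<exists>m>0. s [^] (m::nat) \<in> B"
  shows "\<exists>F. finite F \<and> F \<subseteq> carrier G \<and> generate G (S \<union> B) \<subseteq> B <#> F"
  using \<open>finite S\<close> \<open>S \<subseteq> A\<close> tors
proof (induction S rule: finite_induct)
  case empty
  have "generate G B \<subseteq> B"
    by (rule generate_subgroup_incl[OF order_refl B])
  then show ?case
    using subgroup.subset[OF B] by (intro exI[of _ "{\<one>}"]) (force simp: set_mult_def)
next
  case (insert s S)
  then obtain F where F: "finite F" "F \<subseteq> carrier G" "generate G (S \<union> B) \<subseteq> B <#> F"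
    by auto
  obtain m :: nat where "m > 0" and m: "s [^] m \<in> B"
    using insert.prems by blast
  let ?C = "generate G (S \<union> B)"
  have s: "s \<in> A" "s \<in> carrier G"
    using insert.prems subgroup.subset[OF A] by auto
  have sub: "S \<union> B \<subseteq> A"
    using insert.prems \<open>B \<subseteq> A\<close> by auto
  have C: "subgroup ?C G" and "?C \<subseteq> A" and "B \<subseteq> ?C"
    using generate_subgroup_incl[OF sub A] sub subgroup.subset[OF A] generate.incl[of _ "S \<union> B" G]
    by (auto intro!: generate_is_subgroup)
  note C_rules = subgroup.m_closed[OF C] subgroupE(3)[OF C] subgroup.mem_carrier[OF C]
  have conj: "s [^] k \<otimes> c \<otimes> inv (s [^] k) \<in> ?C" if c: "c \<in> ?C" for c and k :: int
  proof -
    have "commutator G (s [^] k) c \<in> B"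
      using comm subgroup_int_pow_closed[OF A s(1)] \<open>?C \<subseteq> A\<close> c by blast
    then have "commutator G (s [^] k) c \<otimes> c \<in> ?C"
      using \<open>B \<subseteq> ?C\<close> c C_rules by blast
    then show ?thesis
      using s c C_rules(3) by (simp add: commutator_def m_assoc)
  qed
  let ?E = "{c \<otimes> s [^] (k::int) | c k. c \<in> ?C}"
  have "subgroup ?E G"
  proof (rule subgroupI)
    show "?E \<subseteq> carrier G"
      using s C_rules by auto
    show "?E \<noteq> {}"
      using generate.one by blast
  next
    fix x assume "x \<in> ?E"
    then obtain c k where x: "x = c \<otimes> s [^] (k::int)" "c \<in> ?C" by blast
    then have "inv x = (s [^] (-k) \<otimes> inv c \<otimes> inv (s [^] (-k))) \<otimes> s [^] (-k)"
      using s C_rules by (simp add: inv_mult_group m_assoc int_pow_neg)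
    with conj[of "inv c" "-k"] x C_rules show "inv x \<in> ?E" by blast
  next
    fix x y assume "x \<in> ?E" "y \<in> ?E"
    then obtain c k d l where x: "x = c \<otimes> s [^] (k::int)" "c \<in> ?C" "y = d \<otimes> s [^] (l::int)" "d \<in> ?C"
      by blast
    then have "x \<otimes> y = (c \<otimes> (s [^] k \<otimes> d \<otimes> inv (s [^] k))) \<otimes> s [^] (k + l)"
      using s C_rules by (simp add: m_assoc inv_cancel_left int_pow_mult)
    with conj[of d k] x C_rules show "x \<otimes> y \<in> ?E" by blast
  qed
  moreover have "insert s S \<union> B \<subseteq> ?E"
  proof -
    have "x \<in> ?E" if "x \<in> ?C" for x
      using that C_rules s by (auto intro!: exI[of _ x] exI[of _ "0::int"])
    moreover have "s \<in> ?E"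
      using s by (auto intro!: exI[of _ \<one>] exI[of _ "1::int"] generate.one)
    moreover have "S \<union> B \<subseteq> ?C"
      by (auto intro: generate.incl)
    ultimately show ?thesis by blast
  qed
  ultimately have gen: "generate G (insert s S \<union> B) \<subseteq> ?E"
    by (intro generate_subgroup_incl)
  let ?F = "(\<lambda>(f, r). f \<otimes> s [^] r) ` (F \<times> {..<m})"
  have "?E \<subseteq> B <#> ?F"
  proof clarify
    fix c and k :: int assume c: "c \<in> ?C"
    define q where "q = k div int m"
    define r where "r = nat (k mod int m)"
    have "r < m" and k: "k = int m * q + int r"
      using \<open>m > 0\<close> by (simp_all add: q_def r_def nat_less_iff)
    have "c \<otimes> (s [^] m) [^] q \<in> ?C"
      using c m \<open>B \<subseteq> ?C\<close> subgroup_int_pow_closed[OF C] C_rules by blast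
    then obtain b f where bf: "b \<in> B" "f \<in> F" "c \<otimes> (s [^] m) [^] q = b \<otimes> f"
      using F unfolding set_mult_def by blast
    have "s [^] k = (s [^] m) [^] q \<otimes> s [^] r"
      using s int_pow_pow[of s "int m" q] by (simp add: k int_pow_mult int_pow_int)
    then have "c \<otimes> s [^] k = c \<otimes> (s [^] m) [^] q \<otimes> s [^] r"
      using c s C_rules(3) by (simp add: m_assoc)
    also have "\<dots> = b \<otimes> (f \<otimes> s [^] r)"
      using bf F(2) s(2) subgroup.mem_carrier[OF B] by (simp add: m_assoc subset_iff)
    finally have "c \<otimes> s [^] k = b \<otimes> (f \<otimes> s [^] r)" .
    moreover have "f \<otimes> s [^] r \<in> ?F"
      using bf(2) \<open>r < m\<close> by (intro image_eqI[of _ _ "(f, r)"]) auto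
    ultimately show "c \<otimes> s [^] k \<in> B <#> ?F"
      using bf(1) unfolding set_mult_def by blast
  qed
  with gen have "generate G (insert s S \<union> B) \<subseteq> B <#> ?F"
    by (rule order_trans)
  moreover have "finite ?F" "?F \<subseteq> carrier G"
    using F s by auto
  ultimately show ?case
    by (intro exI[of _ ?F] conjI)
qed

lemma finite_rcosets_if_finite_cover:
  assumes H: "subgroup H G" and "finite F" "F \<subseteq> carrier G" "carrier G \<subseteq> H <#> F"
  shows "finite (rcosets H)"
proof (rule finite_subset)
  show "rcosets H \<subseteq> (\<lambda>t. H #> t) ` F"
  proof
    fix C assume "C \<in> rcosets H"
    then obtain x where x: "x \<in> carrier G" "C = H #> x"
      unfolding RCOSETS_def by blast
    then obtain a t where "a \<in> H" "t \<in> F" "x = a \<otimes> t"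
      using assms(4) unfolding set_mult_def by blast
    then have "x \<in> H #> t"
      unfolding r_coset_def by blast
    with \<open>t \<in> F\<close> x assms show "C \<in> (\<lambda>t. H #> t) ` F"
      using repr_independence by blast
  qed
qed (use assms in simp)

end

section \<open>The lower central series\<close>

(* Unfolded terms of the series would no longer match the facts about them below. *)
declare lower_central_series.simps(2) [simp del]

lemma set_multI: "x \<in> A \<Longrightarrow> y \<in> B \<Longrightarrow> x \<otimes>\<^bsub>G\<^esub> y \<in> A <#>\<^bsub>G\<^esub> B"
  unfolding set_mult_def by blast

lemma set_multE:
  assumes "z \<in> A <#>\<^bsub>G\<^esub> B"
  obtains x y where "x \<in> A" "y \<in> B" "z = x \<otimes>\<^bsub>G\<^esub> y"
  using assms unfolding set_mult_def by blast

context group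
begin

abbreviation "\<gamma> \<equiv> lower_central_series G"

lemma lower_central_series_Suc:
  "\<gamma> (Suc i) = generate G {commutator G x y | x y. x \<in> \<gamma> i \<and> y \<in> carrier G}"
  by (simp add: commutator_def lower_central_series.simps(2))

lemma lower_central_series_normal: "\<gamma> i \<lhd> G"
proof (induction i)
  case 0
  then show ?case by (simp add: normal_self)
next
  case (Suc i)
  note in_G = subgroup.mem_carrier[OF normal_imp_subgroup[OF Suc]]
  let ?S = "{commutator G x y | x y. x \<in> \<gamma> i \<and> y \<in> carrier G}"
  have "generate G ?S \<lhd> G"
  proof (rule normal_generateI)
    show "?S \<subseteq> carrier G"
      using in_G by auto
  next
    fix c g assume "c \<in> ?S" and g: "g \<in> carrier G"
    then obtain x y where xy: "x \<in> \<gamma> i" "y \<in> carrier G" "c = commutator G x y" by blast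
    then have "g \<otimes> c \<otimes> inv g = commutator G (g \<otimes> x \<otimes> inv g) (g \<otimes> y \<otimes> inv g)"
      using g in_G[OF xy(1)] by (simp add: commutator_def inv_mult_group m_assoc inv_cancel_left)
    moreover have "g \<otimes> x \<otimes> inv g \<in> \<gamma> i"
      using normal_invE(2)[OF Suc g xy(1)] .
    ultimately show "g \<otimes> c \<otimes> inv g \<in> ?S"
      using xy(2) g by blast
  qed
  then show ?case
    by (simp only: lower_central_series_Suc)
qed

lemmas lower_central_series_subgroup = normal_imp_subgroup[OF lower_central_series_normal]
lemmas lower_central_series_in_carrier = subgroup.mem_carrier[OF lower_central_series_subgroup]

lemma commutator_in_lower_central_series:
  assumes "x \<in> \<gamma> i" "y \<in> carrier G"
  shows "commutator G x y \<in> \<gamma> (Suc i)" "commutator G y x \<in> \<gamma> (Suc i)"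
proof -
  show *: "commutator G x y \<in> \<gamma> (Suc i)"
    unfolding lower_central_series_Suc using assms by (intro generate.incl) blast
  show "commutator G y x \<in> \<gamma> (Suc i)"
    using subgroupE(3)[OF lower_central_series_subgroup *]
      inv_commutator[OF lower_central_series_in_carrier[OF assms(1)] assms(2)] by simp
qed

lemma lower_central_series_decreasing: "\<gamma> (Suc i) \<subseteq> \<gamma> i"
  unfolding lower_central_series_Suc
proof (rule generate_subgroup_incl[OF _ lower_central_series_subgroup], clarify)
  fix x y assume x: "x \<in> \<gamma> i" and y: "y \<in> carrier G"
  have "commutator G x y = x \<otimes> (y \<otimes> inv x \<otimes> inv y)"
    using lower_central_series_in_carrier[OF x] y by (simp add: commutator_def m_assoc)
  also have "\<dots> \<in> \<gamma> i"
    using subgroup.m_closed[OF lower_central_series_subgroup x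
        normal_invE(2)[OF lower_central_series_normal y
          subgroupE(3)[OF lower_central_series_subgroup x]]] .
  finally show "commutator G x y \<in> \<gamma> i" .
qed

lemma lower_central_series_one_eq_derived: "\<gamma> (Suc 0) = derived G (carrier G)"
  unfolding lower_central_series_Suc derived_def commutator_def
  by (intro arg_cong[of _ _ "generate G"]) auto

text \<open>
  Torsion over \<open>H\<close> propagates down the lower central series: the commutator of two elements
  with powers in \<open>H\<close>, up to the next term of the series, has such a power again.
\<close>
lemma commutator_torsion_step:
  assumes H: "subgroup H G"
    and s: "s \<in> \<gamma> i" "s [^] (m::nat) \<in> (H \<inter> \<gamma> i) <#> \<gamma> (Suc i)"
    and t: "t \<in> carrier G" "t [^] (n::nat) \<in> H <#> \<gamma> (Suc 0)"
  shows "commutator G s t [^] (m * n) \<in> (H \<inter> \<gamma> (Suc i)) <#> \<gamma> (Suc (Suc i))"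
proof -
  obtain h l where hl: "h \<in> H" "h \<in> \<gamma> i" "l \<in> \<gamma> (Suc i)" "s [^] m = h \<otimes> l"
    using s(2) unfolding set_mult_def by blast
  obtain h' l' where hl': "h' \<in> H" "l' \<in> \<gamma> (Suc 0)" "t [^] n = h' \<otimes> l'"
    using t(2) unfolding set_mult_def by blast
  note in_G = lower_central_series_in_carrier subgroup.mem_carrier[OF H]
  note step = commutator_in_lower_central_series(1)
  have "\<exists>c\<in>\<gamma> (Suc (Suc i)). commutator G s t [^] (m * n) = commutator G h h' \<otimes> c"
  proof (rule commutator_pow_modulo_normal[OF lower_central_series_normal])
    show "s \<in> carrier G" "t \<in> carrier G" "h \<in> carrier G" "h' \<in> carrier G" "l \<in> carrier G"
      using in_G(1)[OF s(1)] t(1) in_G(2)[OF hl(1)] in_G(2)[OF hl'(1)] in_G(1)[OF hl(3)] .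
    show "s [^] m = h \<otimes> l" "t [^] n = h' \<otimes> l'" by fact+
    show "l' \<in> derived G (carrier G)"
      using hl'(2) lower_central_series_one_eq_derived by blast
    show "commutator G l z \<in> \<gamma> (Suc (Suc i))" if "z \<in> carrier G" for z
      using step[OF hl(3) that] .
    show "commutator G (commutator G s y) z \<in> \<gamma> (Suc (Suc i))"
      "commutator G (commutator G h y) z \<in> \<gamma> (Suc (Suc i))"
      if "y \<in> carrier G" "z \<in> carrier G" for y z
      using step[OF step[OF s(1) that(1)] that(2)] step[OF step[OF hl(2) that(1)] that(2)] .
  qed
  then obtain c where c: "c \<in> \<gamma> (Suc (Suc i))" "commutator G s t [^] (m * n) = commutator G h h' \<otimes> c" ..
  have "commutator G h h' \<in> H"
    using hl(1) hl'(1) subgroup.m_closed[OF H] subgroupE(3)[OF H] by (simp add: commutator_def)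
  moreover have "commutator G h h' \<in> \<gamma> (Suc i)"
    using step[OF hl(2) in_G(2)[OF hl'(1)]] .
  ultimately show ?thesis
    unfolding c(2) by (intro set_multI[OF _ c(1)] IntI)
qed

text \<open>
  The factor \<open>\<gamma> (i + 1) / \<gamma> (i + 2)\<close> is generated by the commutators of generators of
  \<open>\<gamma> i / \<gamma> (i + 1)\<close> with generators of \<open>G\<close>. Hence each factor inherits from the abelianization
  both finite generation and torsion over \<open>H\<close>.
\<close>
lemma lower_central_factor_torsion_generators:
  assumes H: "subgroup H G"
    and X: "finite X" "X \<subseteq> carrier G" "carrier G \<subseteq> generate G X"
    and tors: "\<forall>x\<in>X. \<exists>n>0. x [^] (n::nat) \<in> H <#> \<gamma> (Suc 0)"
  shows "\<exists>S. finite S \<and> S \<subseteq> \<gamma> i \<and> \<gamma> i \<subseteq> generate G (S \<union> \<gamma> (Suc i)) \<and>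
           (\<forall>s\<in>S. \<exists>m>0. s [^] (m::nat) \<in> (H \<inter> \<gamma> i) <#> \<gamma> (Suc i))"
proof (induction i)
  case 0
  have "H \<inter> carrier G = H"
    using subgroup.subset[OF H] by blast
  moreover have "generate G X \<subseteq> generate G (X \<union> \<gamma> (Suc 0))"
    by (intro mono_generate) blast
  then have "carrier G \<subseteq> generate G (X \<union> \<gamma> (Suc 0))"
    using X(3) by (rule order_trans[rotated])
  ultimately show ?case
    using X tors by (intro exI[of _ X]) simp
next
  case (Suc i)
  then obtain S where S: "finite S" "S \<subseteq> \<gamma> i" "\<gamma> i \<subseteq> generate G (S \<union> \<gamma> (Suc i))"
    and S_tors: "\<forall>s\<in>S. \<exists>m>0. s [^] (m::nat) \<in> (H \<inter> \<gamma> i) <#> \<gamma> (Suc i)"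
    by (elim exE conjE) (rule that)
  let ?S = "(\<lambda>(s, x). commutator G s x) ` (S \<times> X)"
  let ?U = "generate G (?S \<union> \<gamma> (Suc (Suc i)))"
  have S_sub: "?S \<subseteq> \<gamma> (Suc i)"
    using S(2) X(2)
    by (auto simp: subset_iff intro!: commutator_in_lower_central_series(1))
  have "?S \<union> \<gamma> (Suc (Suc i)) \<subseteq> carrier G"
    using S_sub lower_central_series_in_carrier by blast
  then have U: "subgroup ?U G"
    by (rule generate_is_subgroup)
  have "\<gamma> (Suc (Suc i)) \<subseteq> ?U"
    by (auto intro: generate.incl)
  have "commutator G a g \<in> ?U" if "a \<in> \<gamma> i" "g \<in> carrier G" for a g
  proof (rule commutators_in_subgroup_of_generators[OF U lower_central_series_subgroup _ _ S(3) X(2,3) _ that])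
    show "S \<union> \<gamma> (Suc i) \<subseteq> \<gamma> i"
      using S(2) lower_central_series_decreasing by blast
    show "commutator G z (commutator G x y) \<in> ?U"
      if "x \<in> \<gamma> i" "y \<in> carrier G" "z \<in> carrier G" for x y z
      using \<open>\<gamma> (Suc (Suc i)) \<subseteq> ?U\<close>
        commutator_in_lower_central_series(2)[OF commutator_in_lower_central_series(1)[OF that(1,2)] that(3)]
      by (rule subsetD)
    show "commutator G s x \<in> ?U" if "s \<in> S \<union> \<gamma> (Suc i)" "x \<in> X" for s x
    proof (cases "s \<in> S")
      case True
      then have "commutator G s x \<in> ?S"
        using that(2) by (intro image_eqI[of _ _ "(s, x)"]) auto
      then show ?thesis
        by (intro generate.incl) blast
    next
      case False
      with that have "s \<in> \<gamma> (Suc i)" by blast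
      moreover have "x \<in> carrier G"
        using that(2) X(2) by blast
      ultimately have "commutator G s x \<in> \<gamma> (Suc (Suc i))"
        by (rule commutator_in_lower_central_series(1))
      then show ?thesis
        using \<open>\<gamma> (Suc (Suc i)) \<subseteq> ?U\<close> by (rule subsetD[rotated])
    qed
  qed
  then have "{commutator G x y | x y. x \<in> \<gamma> i \<and> y \<in> carrier G} \<subseteq> ?U"
    by blast
  then have sub_U: "\<gamma> (Suc i) \<subseteq> ?U"
    unfolding lower_central_series_Suc[of i] by (rule generate_subgroup_incl[OF _ U])
  have tors': "\<exists>m>0. c [^] (m::nat) \<in> (H \<inter> \<gamma> (Suc i)) <#> \<gamma> (Suc (Suc i))" if c: "c \<in> ?S" for c
  proof -
    obtain s x where sx: "s \<in> S" "x \<in> X" "c = commutator G s x"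
      using c by auto
    obtain m n :: nat where "m > 0" "n > 0" and pow: "s [^] m \<in> (H \<inter> \<gamma> i) <#> \<gamma> (Suc i)"
      "x [^] n \<in> H <#> \<gamma> (Suc 0)"
      using bspec[OF S_tors sx(1)] bspec[OF tors sx(2)] by blast
    have "s \<in> \<gamma> i" "x \<in> carrier G"
      using sx S(2) X(2) by auto
    then have "c [^] (m * n) \<in> (H \<inter> \<gamma> (Suc i)) <#> \<gamma> (Suc (Suc i))"
      unfolding sx(3) by (rule commutator_torsion_step[OF H _ pow(1) _ pow(2)])
    then show ?thesis
      using \<open>m > 0\<close> \<open>n > 0\<close> by (intro exI[of _ "m * n"]) simp
  qed
  have "finite ?S"
    using S(1) X(1) by blast
  then show ?case
    by (intro exI[of _ ?S] conjI ballI S_sub sub_U tors')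
qed

lemma subgroup_normal_product:
  assumes "subgroup H G" "N \<lhd> G"
  shows "subgroup (H <#> N) G"
  using mult_norm_subgroup[OF assms(2,1)] commut_normal[OF assms] by simp

text \<open>
  The group \<open>B = (H \<inter> \<gamma> i) <#> \<gamma> (i + 1)\<close> has finite index in \<open>\<gamma> i\<close>, the quotient being a finitely
  generated abelian torsion group. Substituting a cover of \<open>\<gamma> i\<close> by cosets of \<open>B\<close> into one of \<open>G\<close>
  by cosets of \<open>H <#> \<gamma> i\<close> lets \<open>H\<close> absorb the factor \<open>H \<inter> \<gamma> i\<close>. The sets \<open>H \<inter> \<gamma> i\<close> enter, rather
  than \<open>H\<close>, because \<open>B\<close> must lie inside \<open>\<gamma> i\<close>.
\<close>
lemma finite_cover_modulo_lower_central_series: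
  assumes H: "subgroup H G"
    and X: "finite X" "X \<subseteq> carrier G" "carrier G \<subseteq> generate G X"
    and tors: "\<forall>x\<in>X. \<exists>n>0. x [^] (n::nat) \<in> H <#> \<gamma> (Suc 0)"
  shows "\<exists>F. finite F \<and> F \<subseteq> carrier G \<and> carrier G \<subseteq> (H <#> \<gamma> i) <#> F"
proof (induction i)
  case 0
  have "x \<in> (H <#> carrier G) <#> {\<one>}" if "x \<in> carrier G" for x
    using that subgroup.one_closed[OF H] unfolding set_mult_def by force
  then show ?case
    by (intro exI[of _ "{\<one>}"]) auto
next
  case (Suc i)
  then obtain F where F: "finite F" "F \<subseteq> carrier G" "carrier G \<subseteq> (H <#> \<gamma> i) <#> F"
    by (elim exE conjE) (rule that)
  obtain S where S: "finite S" "S \<subseteq> \<gamma> i" "\<gamma> i \<subseteq> generate G (S \<union> \<gamma> (Suc i))"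
    and S_tors: "\<forall>s\<in>S. \<exists>m>0. s [^] (m::nat) \<in> (H \<inter> \<gamma> i) <#> \<gamma> (Suc i)"
    using lower_central_factor_torsion_generators[OF H X tors, of i]
    by (elim exE conjE) (rule that)
  let ?B = "(H \<inter> \<gamma> i) <#> \<gamma> (Suc i)"
  note sub = lower_central_series_subgroup
  have B: "subgroup ?B G"
    by (intro subgroup_normal_product subgroups_Inter_pair H sub lower_central_series_normal)
  have "?B \<subseteq> \<gamma> i"
    using lower_central_series_decreasing[of i]
    by (auto elim!: set_multE intro!: subgroup.m_closed[OF sub])
  have B_ge: "\<gamma> (Suc i) \<subseteq> ?B"
  proof
    fix l assume l: "l \<in> \<gamma> (Suc i)"
    then have "l = \<one> \<otimes> l"
      using lower_central_series_in_carrier[OF l] by simp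
    moreover have "\<one> \<otimes> l \<in> ?B"
      by (intro set_multI IntI l subgroup.one_closed H sub)
    ultimately show "l \<in> ?B" by simp
  qed
  have "commutator G x y \<in> ?B" if "x \<in> \<gamma> i" "y \<in> \<gamma> i" for x y
    using commutator_in_lower_central_series(1)[OF that(1) lower_central_series_in_carrier[OF that(2)]]
      B_ge by blast
  then have "\<exists>E. finite E \<and> E \<subseteq> carrier G \<and> generate G (S \<union> ?B) \<subseteq> ?B <#> E"
    by (rule finite_cover_of_torsion_extension[OF B sub S(1,2) \<open>?B \<subseteq> \<gamma> i\<close> _ bspec[OF S_tors]])
  then obtain E where E: "finite E" "E \<subseteq> carrier G" "generate G (S \<union> ?B) \<subseteq> ?B <#> E"
    by (elim exE conjE) (rule that)
  have "S \<union> \<gamma> (Suc i) \<subseteq> S \<union> ?B"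
    using B_ge by (intro Un_mono) auto
  then have "\<gamma> i \<subseteq> ?B <#> E"
    by (rule order_trans[OF S(3) order_trans[OF mono_generate E(3)]])
  let ?F = "(\<lambda>(e, f). e \<otimes> f) ` (E \<times> F)"
  have cover: "x \<in> (H <#> \<gamma> (Suc i)) <#> ?F" if "x \<in> carrier G" for x
  proof -
    obtain h l f where x: "h \<in> H" "l \<in> \<gamma> i" "f \<in> F" "x = h \<otimes> l \<otimes> f"
      using subsetD[OF F(3) \<open>x \<in> carrier G\<close>] by (elim set_multE) blast
    obtain h' l' e where l: "h' \<in> H" "l' \<in> \<gamma> (Suc i)" "e \<in> E" "l = h' \<otimes> l' \<otimes> e"
      using subsetD[OF \<open>\<gamma> i \<subseteq> ?B <#> E\<close> x(2)] by (elim set_multE) blast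
    have "x = (h \<otimes> h') \<otimes> l' \<otimes> (e \<otimes> f)"
      using x(1,3) l(1,3) subgroup.mem_carrier[OF H] lower_central_series_in_carrier[OF l(2)] E(2) F(2)
      unfolding x(4) l(4) by (simp add: m_assoc subset_iff)
    moreover have "h \<otimes> h' \<in> H"
      using subgroup.m_closed[OF H x(1) l(1)] .
    moreover have "e \<otimes> f \<in> ?F"
      using x(3) l(3) by (intro image_eqI[of _ _ "(e, f)"]) auto
    ultimately show ?thesis
      using l(2) by (auto intro!: set_multI)
  qed
  have "finite ?F" "?F \<subseteq> carrier G"
    using E F by auto
  moreover have "carrier G \<subseteq> (H <#> \<gamma> (Suc i)) <#> ?F"
    by (rule subsetI) (rule cover)
  ultimately show ?case
    by (intro exI[of _ ?F] conjI)
qed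

text \<open>
  For a finitely generated nilpotent group, finiteness of the index of a subgroup can be tested in
  the abelianization: at the end of the series the factor \<open>\<gamma> k\<close> is trivial.
\<close>
lemma nilpotent_finite_index_if_torsion_in_abelianization:
  assumes H: "subgroup H G" and nil: "\<gamma> k = {\<one>}"
    and X: "finite X" "X \<subseteq> carrier G" "carrier G \<subseteq> generate G X"
    and tors: "\<forall>x\<in>X. \<exists>n>0. x [^] (n::nat) \<in> H <#> derived G (carrier G)"
  shows "finite (rcosets H)"
proof -
  have "H <#> \<gamma> k = H"
    using nil subgroup.mem_carrier[OF H] by (auto simp: set_mult_def)
  with finite_cover_modulo_lower_central_series[OF H X tors[folded lower_central_series_one_eq_derived], of k]
  obtain F where "finite F" "F \<subseteq> carrier G" "carrier G \<subseteq> H <#> F"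
    by auto
  then show ?thesis
    by (rule finite_rcosets_if_finite_cover[OF H])
qed

section \<open>Subsequences of polynomial sequences\<close>
lemma poly_map_torsion_in_abelianization:
  fixes g :: "nat \<Rightarrow> 'a"
  assumes g: "poly_map_deg_le G d g" and H: "subgroup H G" and "infinite I" "g ` I \<subseteq> H"
  shows "\<exists>D>0. g n [^] (D::nat) \<in> H <#> derived G (carrier G)"
proof -
  define N where "N = derived G (carrier G)"
  define Q where "Q = G Mod N"
  define \<pi> where "\<pi> = (\<lambda>x. N #> x)"
  interpret N: normal N G
    unfolding N_def by (rule derived_self_is_normal)
  interpret Q: comm_group Q
    unfolding Q_def N_def by (rule derived_quot_is_comm_group)
  interpret \<pi>: group_hom G Q \<pi>
    using N.r_coset_hom_Mod by unfold_locales (simp add: Q_def \<pi>_def)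
  have "(\<lambda>n. \<pi> (g n)) ` I \<subseteq> \<pi> ` H"
    using assms(4) by auto
  then obtain D :: nat where "D > 0" and "\<pi> (g n) [^]\<^bsub>Q\<^esub> D \<in> \<pi> ` H"
    using Q.poly_map_torsion_modulo_infinitely_many_values[OF \<pi>.poly_map_deg_le_hom[OF g]
        \<pi>.subgroup_img_is_subgroup[OF H] \<open>infinite I\<close>] by blast
  then obtain h where h: "h \<in> H" "\<pi> (g n [^] D) = \<pi> h"
    using poly_map_deg_le_closed[OF g] by (auto simp: \<pi>.hom_nat_pow)
  then obtain c where "c \<in> N" "g n [^] D = h \<otimes> c"
    using N.r_coset_eqD[of "g n [^] D" h] poly_map_deg_le_closed[OF g, of n] subgroup.mem_carrier[OF H h(1)]
    by (auto simp: \<pi>_def)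
  with h(1) have "g n [^] D \<in> H <#> N"
    by (auto intro!: set_multI)
  with \<open>D > 0\<close> show ?thesis
    unfolding N_def by blast
qed

end

theorem theorem13:
  fixes G :: "('a, 'b) monoid_scheme" and g :: "nat \<Rightarrow> 'a" and I :: "nat set"
  assumes "nilpotent_group G"
    and "poly_map G g"
    and "generate G (range g) = carrier G"
    and "infinite I"
  shows "finite (rcosets\<^bsub>G\<^esub> (generate G (g ` I)))"
proof -
  interpret group G
    using assms(1) by (simp add: nilpotent_group_def)
  obtain k where k: "lower_central_series G k = {\<one>\<^bsub>G\<^esub>}"
    using assms(1) by (auto simp: nilpotent_group_def)
  obtain d where d: "poly_map_deg_le G d g"
    using assms(2) by (auto simp: poly_map_def)
  have g: "g n \<in> carrier G" for n
    using poly_map_deg_le_closed[OF d] .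
  have H: "subgroup (generate G (g ` I)) G"
    using g by (intro generate_is_subgroup) auto
  have gI: "g ` I \<subseteq> generate G (g ` I)"
    by (auto intro: generate.incl)
  have initial: "range g \<subseteq> generate G (g ` {..d})"
    using poly_map_generated_by_initial_values[OF d] by auto
  have "subgroup (generate G (g ` {..d})) G"
    using g by (intro generate_is_subgroup) auto
  then have gen: "carrier G \<subseteq> generate G (g ` {..d})"
    using generate_subgroup_incl[OF initial] assms(3) by simp
  show ?thesis
  proof (rule nilpotent_finite_index_if_torsion_in_abelianization[OF H k _ _ gen])
    show "\<forall>x\<in>g ` {..d}. \<exists>n>0. x [^]\<^bsub>G\<^esub> (n::nat) \<in> generate G (g ` I) <#>\<^bsub>G\<^esub> derived G (carrier G)"
      using poly_map_torsion_in_abelianization[OF d H assms(4) gI] by blast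
  qed (use g in auto)
qed

end
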